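(* Let $\mathbf{s}_1,\dots,\mathbf{s}_m\in\mathbb{R}^n$ be in general linear position, $m\le n+1$, and let $t_1,\dots,t_m\in\mathbb{R}$. Let $\mathbf{u},\mathbf{v},\mathbf{w}_1,\dots,\mathbf{w}_k\in\mathbb{R}^n$, $\alpha,\beta,\gamma_1,\dots,\gamma_k\in\mathbb{R}$ and the sets $\mathfrak{X},\mathcal{S}\subseteq\mathbb{R}\times\mathbb{R}^n$ be as defined in the context. Set $$\mathcal{S}':=\Bigl\{(t,\mathbf{s})\in\mathbb{R}\times\mathbb{R}^n\ \Big|\ \langle\mathbf{s},\mathbf{w}_j\rangle=\gamma_j\ (j=1,\dots,k),\ t=\langle\mathbf{u},\mathbf{s}\rangle-\alpha,\text{ and }\tilde h(\mathbf{s})=0\Bigr\},$$ where $$\tilde h(\mathbf{s}):=\lVert\mathbf{s}\rVert^2-\langle\mathbf{u},\mathbf{s}\rangle^2+2\langle\alpha\mathbf{u}-\mathbf{v},\mathbf{s}\rangle+\beta-\alpha^2.$$ (The condition $\langle\mathbf{s},\mathbf{w}_j\rangle=\gamma_j$ for all $j$ means that $\mathbf{s}$ lies in the affine span of $\mathbf{s}_1,\dots,\mathbf{s}_m$.) Then: (a) For $i=1,\dots,m$ we have $(t_i,\mathbf{s}_i)\in\mathcal{S}'$. (b) $\mathcal{S}'\subseteq\mathcal{S}$. (c) If $|\mathfrak{X}|>1$, then $\mathcal{S}=\mathcal{S}'$.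
   Context: $n,m\ge1$ are integers; $\langle\cdot,\cdot\rangle$ and $\lVert\cdot\rVert$ are the Euclidean inner product and norm on $\mathbb{R}^n$. For $m\le n+1$, points $\mathbf{s}_1,\dots,\mathbf{s}_m$ are in general linear position if their affine span has dimension $m-1$. $\mathfrak{X}:=\{(b,\mathbf{x})\in\mathbb{R}\times\mathbb{R}^n\mid\lVert\mathbf{s}_i-\mathbf{x}\rVert^2=(t_i-b)^2\text{ for }i=1,\dots,m\}$ and $\mathcal{S}:=\{(t,\mathbf{s})\in\mathbb{R}\times\mathbb{R}^n\mid\lVert\mathbf{s}-\mathbf{x}\rVert^2=(t-b)^2\text{ for all }(b,\mathbf{x})\in\mathfrak{X}\}$. Auxiliary data: $U\subseteq\mathbb{R}^n$ is the linear span of the $\mathbf{s}_i-\mathbf{s}_1$ ($2\le i\le m$), which has dimension $m-1$; $k:=n+1-m$; $\mathbf{w}_1,\dots,\mathbf{w}_k$ is an orthonormal basis of $U^\perp$; $\gamma_j:=\langle\mathbf{s}_i,\mathbf{w}_j\rangle$, which does not depend on $i$. $(\mathbf{v},\beta)\in\mathbb{R}^n\times\mathbb{R}$ is the unique pair with $2\langle\mathbf{s}_i,\mathbf{v}\rangle-\beta=\lVert\mathbf{s}_i\rVert^2-t_i^2$ for all $i$ and $\langle\mathbf{v},\mathbf{w}_j\rangle=\gamma_j$ for all $j$. $(\mathbf{u},\alpha)\in\mathbb{R}^n\times\mathbb{R}$ is the unique pair with $\langle\mathbf{s}_i,\mathbf{u}\rangle-\alpha=t_i$ for all $i$ and $\langle\mathbf{u},\mathbf{w}_j\rangle=0$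 for all $j$. *)

theory Defs
  imports "HOL-Analysis.Analysis"
begin

text \<open>Euclidean \<open>n\<close>-space is \<open>real ^ 'n\<close> with \<open>n = CARD('n)\<close>. Families indexed by \<open>1, \<dots>, m\<close> are functions on
  \<open>nat\<close> of which only the values on \<open>{1..m}\<close> are ever used.\<close>

definition general_linear_position :: "nat \<Rightarrow> (nat \<Rightarrow> real ^ 'n) \<Rightarrow> bool" where
  "general_linear_position m s \<longleftrightarrow> aff_dim (affine hull (s ` {1..m})) = int m - 1"

definition frakX :: "nat \<Rightarrow> (nat \<Rightarrow> real ^ 'n) \<Rightarrow> (nat \<Rightarrow> real) \<Rightarrow> (real \<times> (real ^ 'n)) set" where
  "frakX m s t = {(b, x). \<forall>i\<in>{1..m}. (norm (s i - x))\<^sup>2 = (t i - b)\<^sup>2}"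

definition calS :: "nat \<Rightarrow> (nat \<Rightarrow> real ^ 'n) \<Rightarrow> (nat \<Rightarrow> real) \<Rightarrow> (real \<times> (real ^ 'n)) set" where
  "calS m s t = {(\<tau>, \<sigma>). \<forall>(b, x)\<in>frakX m s t. (norm (\<sigma> - x))\<^sup>2 = (\<tau> - b)\<^sup>2}"

definition dirU :: "nat \<Rightarrow> (nat \<Rightarrow> real ^ 'n) \<Rightarrow> (real ^ 'n) set" where
  "dirU m s = span ((\<lambda>i. s i - s 1) ` {2..m})"

definition orthonormal_basis_of :: "(real ^ 'n) set \<Rightarrow> nat \<Rightarrow> (nat \<Rightarrow> real ^ 'n) \<Rightarrow> bool" where
  "orthonormal_basis_of W k w \<longleftrightarrow>
     (\<forall>i\<in>{1..k}. \<forall>j\<in>{1..k}. w i \<bullet> w j = (if i = j then 1 else 0)) \<and> span (w ` {1..k}) = W"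

text \<open>The index \<open>1\<close> is an arbitrary choice: see \<open>gam_indep\<close> below.\<close>

definition gam :: "(nat \<Rightarrow> real ^ 'n) \<Rightarrow> (nat \<Rightarrow> real ^ 'n) \<Rightarrow> nat \<Rightarrow> real" where
  "gam s w j = s 1 \<bullet> w j"

text \<open>The following two predicates characterize the pairs \<open>(v, \<beta>)\<close> and \<open>(u, \<alpha>)\<close>; that each of them
  has exactly one solution is shown in \<open>v_pair_ex1\<close> and \<open>u_pair_ex1\<close>.\<close>

definition v_pair ::
  "nat \<Rightarrow> nat \<Rightarrow> (nat \<Rightarrow> real ^ 'n) \<Rightarrow> (nat \<Rightarrow> real) \<Rightarrow> (nat \<Rightarrow> real ^ 'n) \<Rightarrow> (real ^ 'n) \<times> real \<Rightarrow> bool"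
where
  "v_pair m k s t w = (\<lambda>(v, \<beta>).
     (\<forall>i\<in>{1..m}. 2 * (s i \<bullet> v) - \<beta> = (norm (s i))\<^sup>2 - (t i)\<^sup>2) \<and>
     (\<forall>j\<in>{1..k}. v \<bullet> w j = gam s w j))"

definition u_pair ::
  "nat \<Rightarrow> nat \<Rightarrow> (nat \<Rightarrow> real ^ 'n) \<Rightarrow> (nat \<Rightarrow> real) \<Rightarrow> (nat \<Rightarrow> real ^ 'n) \<Rightarrow> (real ^ 'n) \<times> real \<Rightarrow> bool"
where
  "u_pair m k s t w = (\<lambda>(u, \<alpha>).
     (\<forall>i\<in>{1..m}. s i \<bullet> u - \<alpha> = t i) \<and> (\<forall>j\<in>{1..k}. u \<bullet> w j = 0))"

definition htilde :: "real ^ 'n \<Rightarrow> real \<Rightarrow> real ^ 'n \<Rightarrow> real \<Rightarrow> real ^ 'n \<Rightarrow> real" where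
  "htilde u \<alpha> v \<beta> \<sigma> =
     (norm \<sigma>)\<^sup>2 - (u \<bullet> \<sigma>)\<^sup>2 + 2 * ((\<alpha> *\<^sub>R u - v) \<bullet> \<sigma>) + \<beta> - \<alpha>\<^sup>2"

definition calS' ::
  "nat \<Rightarrow> (nat \<Rightarrow> real ^ 'n) \<Rightarrow> (nat \<Rightarrow> real ^ 'n) \<Rightarrow> real ^ 'n \<Rightarrow> real \<Rightarrow> real ^ 'n \<Rightarrow> real
     \<Rightarrow> (real \<times> (real ^ 'n)) set"
where
  "calS' k s w u \<alpha> v \<beta> = {(\<tau>, \<sigma>). (\<forall>j\<in>{1..k}. \<sigma> \<bullet> w j = gam s w j) \<and>
     \<tau> = u \<bullet> \<sigma> - \<alpha> \<and> htilde u \<alpha> v \<beta> \<sigma> = 0}"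

text \<open>Well-definedness of the auxiliary data.\<close>

lemma dirU_diff:
  assumes "i \<in> {1..m}" shows "s i - s 1 \<in> dirU m s"
proof (cases "i = 1")
  case True then show ?thesis by (simp add: dirU_def span_zero)
next
  case False
  then have "i \<in> {2..m}" using assms by auto
  then show ?thesis unfolding dirU_def by (intro span_base) blast
qed

lemma orthonormal_basis_in:
  assumes "orthonormal_basis_of W k w" "j \<in> {1..k}" shows "w j \<in> W"
  using assms unfolding orthonormal_basis_of_def by (metis imageI span_base)

lemma dirU_orthogonal:
  assumes "orthonormal_basis_of (orthogonal_comp (dirU m s)) k w" "j \<in> {1..k}" "x \<in> dirU m s"
  shows "x \<bullet> w j = 0"
  using orthonormal_basis_in[OF assms(1,2)] assms(3)
  by (auto simp: orthogonal_comp_def orthogonal_def)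

lemma gam_indep:
  assumes "orthonormal_basis_of (orthogonal_comp (dirU m s)) k w" "i \<in> {1..m}" "j \<in> {1..k}"
  shows "s i \<bullet> w j = gam s w j"
  using dirU_orthogonal[OF assms(1,3) dirU_diff[OF assms(2)]] by (simp add: gam_def inner_diff_left)

lemma dirU_independent:
  assumes "1 \<le> m" "general_linear_position m s"
  shows "inj_on (\<lambda>i. s i - s 1) {2..m}" "independent ((\<lambda>i. s i - s 1) ` {2..m})"
    "dim (dirU m s) = m - 1"
proof -
  let ?D = "(\<lambda>i. s i - s 1) ` {2..m}"
  have e: "{1..m} = insert 1 {2..m}" using assms(1) by auto
  have "aff_dim (s ` {1..m}) = int (dim ((\<lambda>x. x - s 1) ` (s ` {1..m})))"
    using assms(1) by (intro aff_dim_eq_dim_subtract hull_inc) auto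
  also have "(\<lambda>x. x - s 1) ` (s ` {1..m}) = insert 0 ?D"
    unfolding e by (auto simp: image_image)
  also have "dim (insert 0 ?D) = dim ?D" by (metis dim_span span_insert_0)
  finally have d: "dim ?D = m - 1"
    using assms unfolding general_linear_position_def by (simp add: aff_dim_affine_hull)
  have "card ?D \<le> m - 1" using card_image_le[of "{2..m}" "\<lambda>i. s i - s 1"] by simp
  moreover have "dim ?D \<le> card ?D" by (simp add: dim_le_card')
  ultimately have c: "card ?D = m - 1" using d by simp
  show "inj_on (\<lambda>i. s i - s 1) {2..m}" using c by (intro eq_card_imp_inj_on) auto
  show "independent ?D" using c d by (intro card_le_dim_spanning[of _ "span ?D"]) (auto simp: span_superset)
  show "dim (dirU m s) = m - 1" using d by (simp add: dirU_def)
qed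

lemma orthonormal_basis_exists:
  fixes s :: "nat \<Rightarrow> real ^ 'n"
  assumes "1 \<le> m" "m \<le> CARD('n) + 1" "general_linear_position m s" "k = CARD('n) + 1 - m"
  shows "\<exists>w. orthonormal_basis_of (orthogonal_comp (dirU m s)) k w"
proof -
  let ?W = "orthogonal_comp (dirU m s)"
  have "dim {y \<in> UNIV. \<forall>x \<in> dirU m s. orthogonal x y} + dim (dirU m s) = dim (UNIV :: (real ^ 'n) set)"
    by (intro dim_subspace_orthogonal_to_vectors) (auto simp: dirU_def)
  moreover have "{y \<in> UNIV. \<forall>x \<in> dirU m s. orthogonal x y} = ?W"
    by (auto simp: orthogonal_comp_def orthogonal_commute)
  ultimately have dW: "dim ?W = k" using dirU_independent(3)[OF assms(1,3)] assms by simp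
  obtain B where B: "pairwise orthogonal B" "\<And>x. x \<in> B \<Longrightarrow> norm x = 1" "independent B"
    "card B = dim ?W" "span B = ?W"
    by (rule orthonormal_basis_subspace[OF subspace_orthogonal_comp[of "dirU m s"]]) blast
  have "finite B" using B(3) by (rule independent_imp_finite)
  then obtain w where w: "bij_betw w {1..k} B"
    using finite_same_card_bij[of "{1..k}" B] B(4) dW by auto
  have "w i \<bullet> w j = (if i = j then 1 else 0)" if ij: "i \<in> {1..k}" "j \<in> {1..k}" for i j
  proof -
    have in_B: "w i \<in> B" "w j \<in> B" using w ij by (auto simp: bij_betw_def)
    have "w i \<noteq> w j" if "i \<noteq> j"
      using w ij that unfolding bij_betw_def by (metis inj_on_contraD)
    then show ?thesis
      using pairwiseD[OF B(1) in_B] B(2)[OF in_B(2)]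
      by (cases "i = j") (simp_all add: orthogonal_def dot_square_norm)
  qed
  moreover have "w ` {1..k} = B" using w by (simp add: bij_betw_def)
  ultimately show ?thesis using B(5) unfolding orthonormal_basis_of_def by blast
qed

lemma affine_system_ex1:
  fixes s :: "nat \<Rightarrow> real ^ 'n"
  assumes m: "1 \<le> m" and gp: "general_linear_position m s"
    and w: "orthonormal_basis_of (orthogonal_comp (dirU m s)) k w"
  shows "\<exists>!(x, c). (\<forall>i\<in>{1..m}. s i \<bullet> x - c = r i) \<and> (\<forall>j\<in>{1..k}. x \<bullet> w j = g j)"
proof -
  have ortho: "w i \<bullet> w j = (if i = j then 1 else 0)" if "i \<in> {1..k}" "j \<in> {1..k}" for i j
    using w that by (auto simp: orthonormal_basis_of_def)
  have spn: "span (w ` {1..k}) = orthogonal_comp (dirU m s)"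
    using w by (auto simp: orthonormal_basis_of_def)
  let ?d = "\<lambda>i. s i - s 1"
  note ind = dirU_independent[OF m gp]
  let ?f = "\<lambda>y. r (inv_into {2..m} ?d y) - r 1"
  obtain L where L: "linear L" "\<And>y. y \<in> ?d ` {2..m} \<Longrightarrow> L y = ?f y"
    using linear_independent_extend[OF ind(2), of ?f] by blast
  define x1 where "x1 = adjoint L 1"
  have L1: "?d i \<bullet> x1 = r i - r 1" if "i \<in> {1..m}" for i
  proof (cases "i = 1")
    case False
    then have i: "i \<in> {2..m}" using that by auto
    have "?d i \<bullet> x1 = L (?d i)"
      unfolding x1_def using adjoint_works[OF L(1), of "?d i" 1] by simp
    also have "\<dots> = r i - r 1" using L(2)[of "?d i"] i inv_into_f_f[OF ind(1) i] by simp
    finally show ?thesis .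
  qed simp
  define x where "x = x1 + (\<Sum>j\<in>{1..k}. (g j - x1 \<bullet> w j) *\<^sub>R w j)"
  have xd: "?d i \<bullet> x = r i - r 1" if "i \<in> {1..m}" for i
    using L1[OF that] dirU_orthogonal[OF w _ dirU_diff[OF that]]
    by (simp add: x_def inner_add_right inner_sum_right)
  have xw: "x \<bullet> w j = g j" if "j \<in> {1..k}" for j
  proof -
    have "(\<Sum>l\<in>{1..k}. (g l - x1 \<bullet> w l) *\<^sub>R w l) \<bullet> w j
        = (\<Sum>l\<in>{1..k}. if l = j then g l - x1 \<bullet> w l else 0)"
      unfolding inner_sum_left by (intro sum.cong refl) (use ortho that in auto)
    then show ?thesis using that by (simp add: x_def inner_add_left)
  qed
  show ?thesis
  proof (rule ex1I[of _ "(x, s 1 \<bullet> x - r 1)"])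
    show "case (x, s 1 \<bullet> x - r 1) of (x, c) \<Rightarrow>
        (\<forall>i\<in>{1..m}. s i \<bullet> x - c = r i) \<and> (\<forall>j\<in>{1..k}. x \<bullet> w j = g j)"
      using xd xw by (auto simp: inner_diff_left algebra_simps)
  next
    fix p assume p: "case p of (x, c) \<Rightarrow>
        (\<forall>i\<in>{1..m}. s i \<bullet> x - c = r i) \<and> (\<forall>j\<in>{1..k}. x \<bullet> w j = g j)"
    obtain y c where y: "p = (y, c)" by (cases p)
    have y1: "s i \<bullet> y - c = r i" if "i \<in> {1..m}" for i using p y that by auto
    have y2: "y \<bullet> w j = g j" if "j \<in> {1..k}" for j using p y that by auto
    let ?z = "y - x"
    have "orthogonal ?z b" if "b \<in> w ` {1..k}" for b
      using that y2 xw by (auto simp: orthogonal_def inner_diff_left)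
    then have a: "orthogonal ?z b" if "b \<in> orthogonal_comp (dirU m s)" for b
      using orthogonal_to_span[of b "w ` {1..k}" ?z] that spn by blast
    have "orthogonal ?z b" if "b \<in> ?d ` {2..m}" for b
    proof -
      obtain i where i: "b = ?d i" "i \<in> {1..m}" using \<open>b \<in> ?d ` {2..m}\<close> by auto
      have "?d i \<bullet> y = r i - r 1"
        using y1[OF i(2)] y1[of 1] m by (simp add: inner_diff_left)
      then have "?d i \<bullet> ?z = 0" using xd[OF i(2)] by (simp add: inner_diff_right)
      then show ?thesis unfolding i(1) orthogonal_def by (simp only: inner_commute)
    qed
    then have "orthogonal ?z b" if "b \<in> dirU m s" for b
      using orthogonal_to_span[of b "?d ` {2..m}" ?z] that unfolding dirU_def by blast
    then have "?z \<in> orthogonal_comp (dirU m s)"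
      by (auto simp: orthogonal_comp_def orthogonal_commute)
    then have "?z \<bullet> ?z = 0" using a unfolding orthogonal_def by blast
    then have "y = x" by simp
    then show "p = (x, s 1 \<bullet> x - r 1)" using y y1[of 1] m by simp
  qed
qed

lemma u_pair_ex1:
  assumes "1 \<le> m" "general_linear_position m s"
    "orthonormal_basis_of (orthogonal_comp (dirU m s)) k w"
  shows "\<exists>!p. u_pair m k s t w p"
  unfolding u_pair_def using affine_system_ex1[OF assms, of t "\<lambda>_. 0"] by simp

lemma v_pair_ex1:
  assumes "1 \<le> m" "general_linear_position m s"
    "orthonormal_basis_of (orthogonal_comp (dirU m s)) k w"
  shows "\<exists>!p. v_pair m k s t w p"
proof -
  let ?P = "\<lambda>(x, c). (\<forall>i\<in>{1..m}. s i \<bullet> x - c = ((norm (s i))\<^sup>2 - (t i)\<^sup>2) / 2) \<and>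
    (\<forall>j\<in>{1..k}. x \<bullet> w j = gam s w j)"
  have iff: "v_pair m k s t w (x, c) \<longleftrightarrow> ?P (x, c / 2)" for x c
    unfolding v_pair_def by (auto simp: field_simps)
  have ex: "\<exists>!p. ?P p" by (rule affine_system_ex1[OF assms])
  then obtain p where p: "?P p" "\<And>q. ?P q \<Longrightarrow> q = p" by blast
  obtain x c where xc: "p = (x, c)" by (cases p)
  show ?thesis
  proof (rule ex1I[of _ "(x, 2 * c)"])
    show "v_pair m k s t w (x, 2 * c)" using p(1) xc by (simp add: iff)
  next
    fix q assume q: "v_pair m k s t w q"
    obtain y d where yd: "q = (y, d)" by (cases q)
    have "(y, d / 2) = p" using q yd iff p(2) by blast
    then show "q = (x, 2 * c)" using yd xc by auto
  qed
qed

end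

theory Submission
  imports Defs
begin

text \<open>Write \<open>V\<close> for the orthogonal complement of \<open>U\<close>. Subtracting the equations of \<open>\<XX>\<close> from each other
  shows that its points are exactly the \<open>(b, v + b u + z)\<close> with \<open>z \<in> V\<close> and \<open>\<parallel>z\<parallel>\<^sup>2 = f b\<close> for a fixed
  quadratic polynomial \<open>f\<close>. On such a point the equation defining \<open>\<S>\<close> becomes affine in \<open>(b, z)\<close>, namely
  \<open>A + 2 b B - 2 \<langle>\<sigma> - v, z\<rangle> = 0\<close>, and \<open>(\<tau>, \<sigma>) \<in> \<S>'\<close> says that \<open>A = B = 0\<close> and that the \<open>V\<close>-component
  \<open>D\<close> of \<open>\<sigma> - v\<close> vanishes. Conversely, if \<open>D \<noteq> 0\<close>, then the symmetry \<open>z \<mapsto> - z\<close> forces \<open>f \<le> 0\<close>; as there are two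
  points, \<open>f\<close> then has two zeros and vanishes identically, so \<open>\<parallel>u\<parallel> = 1\<close> and the equality case of
  Cauchy--Schwarz makes \<open>\<sigma> - v\<close> a multiple of \<open>u\<close>, which contradicts \<open>D \<noteq> 0\<close>. If \<open>D = 0\<close>, then
  \<open>A + 2 b B\<close> vanishes for two values of \<open>b\<close>.\<close>

section \<open>Real quadratics, unit vectors and affine hulls\<close>

text \<open>At the midpoint of \<open>b\<close> and \<open>c\<close> the value is
  \<open>- a * (c - b)\<^sup>2 / 4\<close>, at the reflection of \<open>c\<close> in
  \<open>b\<close> it is \<open>2 * (a * (c - b)\<^sup>2)\<close>. The two signs force
  \<open>a = 0\<close>, and an affine function with two zeros vanishes.\<close>

lemma nonpos_quadratic_two_zeros:
  fixes a p q b c :: real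
  assumes nonpos: "\<And>x. a * x\<^sup>2 + p * x + q \<le> 0"
    and zero: "a * b\<^sup>2 + p * b + q = 0" "a * c\<^sup>2 + p * c + q = 0" and "b \<noteq> c"
  shows "a = 0" "p = 0" "q = 0"
proof -
  let ?f = "\<lambda>x. a * x\<^sup>2 + p * x + q"
  have pos: "(c - b)\<^sup>2 > 0" using \<open>b \<noteq> c\<close> by simp
  have "?f ((b + c) / 2) = (?f b + ?f c) / 2 - a * (c - b)\<^sup>2 / 4"
    by (simp add: power2_eq_square field_simps)
  then have "a * (c - b)\<^sup>2 \<ge> 0" using nonpos[of "(b + c) / 2"] zero by simp
  moreover have "?f (2 * b - c) = 2 * ?f b - ?f c + 2 * (a * (c - b)\<^sup>2)"
    by (simp add: power2_eq_square algebra_simps)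
  then have "a * (c - b)\<^sup>2 \<le> 0" using nonpos[of "2 * b - c"] zero by simp
  ultimately have "a * (c - b)\<^sup>2 = 0" by simp
  then show a: "a = 0" using pos by simp
  have "p * (b - c) = 0" using zero[unfolded a] by (simp only: right_diff_distrib)
  then show "p = 0" using \<open>b \<noteq> c\<close> by simp
  then show "q = 0" using zero a by simp
qed

text \<open>In the sum of the values at \<open>b + d\<close> and \<open>b - d\<close> the odd terms
  in \<open>d\<close> cancel. For small \<open>d\<close> the sum is nonnegative, hence so is one
  summand.\<close>

lemma quadratic_nonneg_nearby:
  fixes a p q b :: real
  assumes "a * b\<^sup>2 + p * b + q > 0"
  obtains c where "c \<noteq> b" "a * c\<^sup>2 + p * c + q \<ge> 0"
proof -
  let ?f = "\<lambda>x. a * x\<^sup>2 + p * x + q"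
  \<comment> \<open>Chosen so that \<open>\<bar>a\<bar> * d\<^sup>2\<close> is at most the value at
    \<open>b\<close>; the added 1 covers \<open>a = 0\<close>.\<close>
  define d where "d = sqrt (?f b / (\<bar>a\<bar> + 1))"
  have d: "d > 0" "d\<^sup>2 = ?f b / (\<bar>a\<bar> + 1)" using assms by (auto simp: d_def)
  have "- a * d\<^sup>2 \<le> (\<bar>a\<bar> + 1) * d\<^sup>2" by (intro mult_right_mono) auto
  also have "\<dots> = ?f b" unfolding d(2) by (simp add: add_nonneg_eq_0_iff)
  finally have "?f b + a * d\<^sup>2 \<ge> 0" by simp
  moreover have "?f (b + d) + ?f (b - d) = 2 * (?f b + a * d\<^sup>2)"
    by (simp add: power2_eq_square algebra_simps)
  ultimately have "?f (b + d) + ?f (b - d) \<ge> 0" by simp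
  then have "?f (b + d) \<ge> 0 \<or> ?f (b - d) \<ge> 0" by linarith
  then show thesis using that[of "b + d"] that[of "b - d"] d(1) by auto
qed

lemma Cauchy_Schwarz_unit_eq:
  fixes x u :: "'a::real_inner"
  assumes "u \<bullet> u = 1" "x \<bullet> x = (u \<bullet> x)\<^sup>2"
  shows "x = (u \<bullet> x) *\<^sub>R u"
proof -
  let ?y = "x - (u \<bullet> x) *\<^sub>R u"
  have "?y \<bullet> ?y = 0" using assms
    by (simp add: inner_diff_left inner_diff_right inner_commute power2_eq_square)
  then show ?thesis by simp
qed

lemma affine_eqs_two_points:
  fixes A B b c :: real
  assumes "A + 2 * b * B = 0" "A + 2 * c * B = 0" "b \<noteq> c"
  shows "A = 0" "B = 0"
proof -
  have "2 * ((b - c) * B) = (A + 2 * b * B) - (A + 2 * c * B)" by (simp add: algebra_simps)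
  then have "(b - c) * B = 0" using assms by simp
  then show "B = 0" using assms(3) by simp
  then show "A = 0" using assms(1) by simp
qed

lemma affine_hull_eq_dirU:
  assumes "1 \<le> m"
  shows "\<sigma> \<in> affine hull (s ` {1..m}) \<longleftrightarrow> \<sigma> - s 1 \<in> dirU m s"
proof -
  have "{1..m} = insert 1 {2..m}" using assms by auto
  then have e: "s ` {1..m} = insert (s 1) (s ` {2..m})" by (simp only: image_insert)
  have "affine hull (s ` {1..m}) = {s 1 + y |y. y \<in> dirU m s}"
    unfolding e affine_hull_insert_span_gen dirU_def
    by (simp add: image_image setcompr_eq_image)
  moreover have "\<sigma> = s 1 + y \<longleftrightarrow> y = \<sigma> - s 1" for y by auto
  ultimately show ?thesis by simp
qed

section \<open>The auxiliary data and the orthogonal complement of the direction space\<close>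

locale cone_system =
  fixes s w :: "nat \<Rightarrow> real ^ 'n" and t :: "nat \<Rightarrow> real"
    and u v :: "real ^ 'n" and \<alpha> \<beta> :: real and m k :: nat
  assumes m: "1 \<le> m"
    and w: "orthonormal_basis_of (orthogonal_comp (dirU m s)) k w"
    and v_pair: "v_pair m k s t w (v, \<beta>)"
    and u_pair: "u_pair m k s t w (u, \<alpha>)"
begin

abbreviation V :: "(real ^ 'n) set" where "V \<equiv> orthogonal_comp (dirU m s)"

text \<open>This is \<open>b\<^sup>2 + 2 * \<alpha> * b + \<beta>\<close> minus the squared norm of
  \<open>v + b *\<^sub>R u\<close>.\<close>

definition f :: "real \<Rightarrow> real" where
  "f b = (1 - u \<bullet> u) * b\<^sup>2 + 2 * (\<alpha> - u \<bullet> v) * b + (\<beta> - v \<bullet> v)"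

text \<open>\<open>A\<close> and \<open>B\<close> measure by how much a point of space-time violates
  the site equations of \<open>v_pair\<close> and \<open>u_pair\<close>.\<close>

definition A :: "real \<Rightarrow> real ^ 'n \<Rightarrow> real" where
  "A \<tau> \<sigma> = \<sigma> \<bullet> \<sigma> - 2 * (\<sigma> \<bullet> v) + \<beta> - \<tau>\<^sup>2"

definition B :: "real \<Rightarrow> real ^ 'n \<Rightarrow> real" where
  "B \<tau> \<sigma> = \<tau> - u \<bullet> \<sigma> + \<alpha>"

lemma orthogonal_V_iff: "(\<forall>z\<in>V. y \<bullet> z = 0) \<longleftrightarrow> (\<forall>j\<in>{1..k}. y \<bullet> w j = 0)"
proof
  assume "\<forall>z\<in>V. y \<bullet> z = 0"
  then show "\<forall>j\<in>{1..k}. y \<bullet> w j = 0" using orthonormal_basis_in[OF w] by blast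
next
  assume *: "\<forall>j\<in>{1..k}. y \<bullet> w j = 0"
  have "orthogonal y x" if "x \<in> w ` {1..k}" for x
    using * that by (auto simp: orthogonal_def)
  then have "y \<bullet> z = 0" if "z \<in> span (w ` {1..k})" for z
    using orthogonal_to_span[OF that] by (simp add: orthogonal_def)
  moreover have "span (w ` {1..k}) = V" using w by (simp add: orthonormal_basis_of_def)
  ultimately show "\<forall>z\<in>V. y \<bullet> z = 0" by simp
qed

lemma u_orthogonal_V: "z \<in> V \<Longrightarrow> u \<bullet> z = 0"
  using u_pair orthogonal_V_iff[of u] by (simp add: u_pair_def)

lemma gam_iff: "(\<forall>j\<in>{1..k}. \<sigma> \<bullet> w j = gam s w j) \<longleftrightarrow> (\<forall>z\<in>V. (\<sigma> - v) \<bullet> z = 0)"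
  using v_pair unfolding orthogonal_V_iff by (simp add: v_pair_def inner_diff_left)

text \<open>The conditions say that \<open>\<sigma> - s 1\<close> is orthogonal to \<open>V\<close>,
  and the double orthogonal complement of a subspace is the subspace itself.\<close>

lemma gam_iff_dirU: "(\<forall>j\<in>{1..k}. \<sigma> \<bullet> w j = gam s w j) \<longleftrightarrow> \<sigma> - s 1 \<in> dirU m s"
proof -
  have "(\<forall>j\<in>{1..k}. \<sigma> \<bullet> w j = gam s w j) \<longleftrightarrow> (\<forall>z\<in>V. (\<sigma> - s 1) \<bullet> z = 0)"
    unfolding orthogonal_V_iff by (simp add: gam_def inner_diff_left)
  also have "\<dots> \<longleftrightarrow> \<sigma> - s 1 \<in> orthogonal_comp V"
    by (auto simp: orthogonal_comp_def[of V] orthogonal_def inner_commute)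
  also have "orthogonal_comp V = dirU m s"
    by (rule orthogonal_comp_self) (simp add: dirU_def)
  finally show ?thesis .
qed

lemma site_orthogonal_V: "i \<in> {1..m} \<Longrightarrow> z \<in> V \<Longrightarrow> (s i - v) \<bullet> z = 0"
  using gam_iff[of "s i"] gam_indep[OF w] by blast

lemma site_residuals:
  assumes "i \<in> {1..m}"
  shows "A (t i) (s i) = 0" "B (t i) (s i) = 0"
proof -
  have "2 * (s i \<bullet> v) - \<beta> = s i \<bullet> s i - (t i)\<^sup>2"
    using v_pair assms by (simp add: v_pair_def power2_norm_eq_inner)
  then show "A (t i) (s i) = 0" by (simp add: A_def)
  have "s i \<bullet> u - \<alpha> = t i" using u_pair assms by (simp add: u_pair_def)
  then show "B (t i) (s i) = 0" by (simp add: B_def inner_commute)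
qed

section \<open>Parametrization of \<open>frakX\<close> and the resulting equations for
  \<open>calS\<close>\<close>

text \<open>Stated for arbitrary \<open>z\<close>, so that it serves twice: at the sites, where
  \<open>A\<close> and \<open>B\<close> vanish, to determine \<open>frakX\<close>, and then for
  arbitrary \<open>\<sigma>\<close> with \<open>z\<close> in \<open>V\<close>.\<close>

lemma cone_identity:
  "(norm (\<sigma> - (v + b *\<^sub>R u + z)))\<^sup>2 - (\<tau> - b)\<^sup>2 =
    A \<tau> \<sigma> + 2 * b * B \<tau> \<sigma> - 2 * ((\<sigma> - v) \<bullet> z) + 2 * b * (u \<bullet> z) + (z \<bullet> z - f b)"
proof -
  have "v \<bullet> \<sigma> = \<sigma> \<bullet> v" "\<sigma> \<bullet> u = u \<bullet> \<sigma>" "v \<bullet> u = u \<bullet> v" "z \<bullet> \<sigma> = \<sigma> \<bullet> z" "z \<bullet> u = u \<bullet> z" "z \<bullet> v = v \<bullet> z"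
    by (rule inner_commute)+
  then show ?thesis
    unfolding power2_norm_eq_inner A_def B_def f_def inner_diff_left inner_diff_right
      inner_add_left inner_add_right inner_scaleR_left inner_scaleR_right
    by (simp add: power2_eq_square algebra_simps)
qed

lemma frakX_iff: "(b, v + b *\<^sub>R u + z) \<in> frakX m s t \<longleftrightarrow> z \<in> V \<and> z \<bullet> z = f b"
proof -
  have X: "(b, v + b *\<^sub>R u + z) \<in> frakX m s t \<longleftrightarrow>
      (\<forall>i\<in>{1..m}. - 2 * ((s i - v) \<bullet> z) + 2 * b * (u \<bullet> z) + (z \<bullet> z - f b) = 0)"
  proof -
    have "(norm (s i - (v + b *\<^sub>R u + z)))\<^sup>2 = (t i - b)\<^sup>2 \<longleftrightarrow>
        - 2 * ((s i - v) \<bullet> z) + 2 * b * (u \<bullet> z) + (z \<bullet> z - f b) = 0" if "i \<in> {1..m}" for i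
      using cone_identity[of "s i" b z "t i"] site_residuals[OF that] by auto
    then show ?thesis unfolding frakX_def by simp
  qed
  show ?thesis
  proof
    assume *: "(b, v + b *\<^sub>R u + z) \<in> frakX m s t"
    \<comment> \<open>Only the first summand of the equation in \<open>X\<close> depends on
      \<open>i\<close>, so subtracting the one for index 1 removes the rest.\<close>
    have diff: "(s i - s 1) \<bullet> z = 0" if "i \<in> {1..m}" for i
    proof -
      have "1 \<in> {1..m}" using m by simp
      from X[THEN iffD1, OF *, rule_format, OF that] X[THEN iffD1, OF *, rule_format, OF this]
      show ?thesis by (simp add: inner_diff_left)
    qed
    then have "orthogonal z y" if "y \<in> (\<lambda>i. s i - s 1) ` {2..m}" for y
      using that by (auto simp: orthogonal_def inner_commute)
    then have "orthogonal z y" if "y \<in> dirU m s" for y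
      using that orthogonal_to_span unfolding dirU_def by blast
    then have z: "z \<in> V" by (auto simp: orthogonal_comp_def orthogonal_commute)
    moreover have "z \<bullet> z = f b"
      using X[THEN iffD1, OF *, rule_format, of 1] m site_orthogonal_V[OF _ z, of 1] u_orthogonal_V[OF z]
      by simp
    ultimately show "z \<in> V \<and> z \<bullet> z = f b" by blast
  next
    assume "z \<in> V \<and> z \<bullet> z = f b"
    then show "(b, v + b *\<^sub>R u + z) \<in> frakX m s t"
      unfolding X using site_orthogonal_V u_orthogonal_V by simp
  qed
qed

lemma frakX_cases:
  assumes "p \<in> frakX m s t"
  obtains b z where "p = (b, v + b *\<^sub>R u + z)" "z \<in> V" "z \<bullet> z = f b"
proof -
  obtain b x where p: "p = (b, x)" by (cases p)
  \<comment> \<open>No condition on \<open>x\<close> is involved: \<open>z\<close> is just the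
    remainder, and \<open>frakX_iff\<close> supplies its properties.\<close>
  have x: "x = v + b *\<^sub>R u + (x - v - b *\<^sub>R u)" by simp
  then have "p = (b, v + b *\<^sub>R u + (x - v - b *\<^sub>R u))" using p by simp
  then show thesis using that frakX_iff assms by metis
qed

lemma calS_iff:
  "(\<tau>, \<sigma>) \<in> calS m s t \<longleftrightarrow>
    (\<forall>b. \<forall>z\<in>V. z \<bullet> z = f b \<longrightarrow> A \<tau> \<sigma> + 2 * b * B \<tau> \<sigma> - 2 * ((\<sigma> - v) \<bullet> z) = 0)"
    (is "_ \<longleftrightarrow> ?R")
proof -
  have cone: "(norm (\<sigma> - (v + b *\<^sub>R u + z)))\<^sup>2 = (\<tau> - b)\<^sup>2 \<longleftrightarrow>
      A \<tau> \<sigma> + 2 * b * B \<tau> \<sigma> - 2 * ((\<sigma> - v) \<bullet> z) = 0" if "z \<in> V" "z \<bullet> z = f b" for b z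
    using cone_identity[of \<sigma> b z \<tau>] u_orthogonal_V[OF that(1)] that(2) by auto
  show ?thesis
  proof
    assume "(\<tau>, \<sigma>) \<in> calS m s t"
    then show ?R using cone frakX_iff unfolding calS_def by blast
  next
    assume R: ?R
    have "case p of (b, x) \<Rightarrow> (norm (\<sigma> - x))\<^sup>2 = (\<tau> - b)\<^sup>2" if p: "p \<in> frakX m s t" for p
      using p
    proof (cases rule: frakX_cases)
      case (1 b z)
      then show ?thesis using R cone by simp
    qed
    then show "(\<tau>, \<sigma>) \<in> calS m s t" unfolding calS_def by blast
  qed
qed

lemma calS'_iff:
  "(\<tau>, \<sigma>) \<in> calS' k s w u \<alpha> v \<beta> \<longleftrightarrow>
    (\<forall>z\<in>V. (\<sigma> - v) \<bullet> z = 0) \<and> A \<tau> \<sigma> = 0 \<and> B \<tau> \<sigma> = 0"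
proof -
  \<comment> \<open>\<open>htilde\<close> is \<open>A\<close> after eliminating the time coordinate
    by \<open>B = 0\<close>.\<close>
  have "htilde u \<alpha> v \<beta> \<sigma> = A \<tau> \<sigma>" if "\<tau> = u \<bullet> \<sigma> - \<alpha>"
    unfolding htilde_def A_def that power2_norm_eq_inner inner_diff_left inner_scaleR_left
      inner_commute[of v \<sigma>]
    by algebra
  moreover have "B \<tau> \<sigma> = 0 \<longleftrightarrow> \<tau> = u \<bullet> \<sigma> - \<alpha>" by (auto simp: B_def)
  ultimately show ?thesis unfolding calS'_def gam_iff by auto
qed

lemma site_in_calS': "i \<in> {1..m} \<Longrightarrow> (t i, s i) \<in> calS' k s w u \<alpha> v \<beta>"
  unfolding calS'_iff using site_orthogonal_V site_residuals by blast

lemma calS'_subset_calS: "calS' k s w u \<alpha> v \<beta> \<subseteq> calS m s t"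
  using calS_iff calS'_iff by auto

section \<open>The converse inclusion when \<open>frakX\<close> has two points\<close>

lemma V_vector_of_square:
  assumes "d \<in> V" "d \<noteq> 0" "c \<ge> 0"
  obtains r where "r *\<^sub>R d \<in> V" "(r *\<^sub>R d) \<bullet> (r *\<^sub>R d) = c"
proof -
  have "(sqrt (c / (d \<bullet> d)))\<^sup>2 * (d \<bullet> d) = c" using assms by simp
  then have "(sqrt (c / (d \<bullet> d)) *\<^sub>R d) \<bullet> (sqrt (c / (d \<bullet> d)) *\<^sub>R d) = c"
    by (simp only: inner_scaleR_left inner_scaleR_right power2_eq_square mult.assoc)
  then show thesis
    using that subspace_scale[OF subspace_orthogonal_comp assms(1)] by blast
qed

lemma calS_subset_calS':
  assumes two: "p \<in> frakX m s t" "q \<in> frakX m s t" "p \<noteq> q"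
  shows "calS m s t \<subseteq> calS' k s w u \<alpha> v \<beta>"
proof clarify
  fix \<tau> \<sigma> assume S: "(\<tau>, \<sigma>) \<in> calS m s t"
  have eq: "A \<tau> \<sigma> + 2 * b * B \<tau> \<sigma> - 2 * ((\<sigma> - v) \<bullet> z) = 0" if "z \<in> V" "z \<bullet> z = f b" for b z
    using S that calS_iff by blast
  obtain b1 z1 where p: "p = (b1, v + b1 *\<^sub>R u + z1)" and z1: "z1 \<in> V" "z1 \<bullet> z1 = f b1"
    using two(1) by (rule frakX_cases)
  obtain b2 z2 where q: "q = (b2, v + b2 *\<^sub>R u + z2)" and z2: "z2 \<in> V" "z2 \<bullet> z2 = f b2"
    using two(2) by (rule frakX_cases)
  have V: "subspace V" by (rule subspace_orthogonal_comp)
  obtain c D where cD: "\<sigma> - v = c + D" and c: "\<And>z. z \<in> V \<Longrightarrow> c \<bullet> z = 0" and D: "D \<in> V"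
  proof -
    obtain y z where "y \<in> span V" "\<And>x. x \<in> span V \<Longrightarrow> orthogonal z x" "\<sigma> - v = y + z"
      using orthogonal_subspace_decomp_exists[of V "\<sigma> - v"] by blast
    then show thesis
      using that[of z y] V by (simp add: span_eq_iff[THEN iffD2] orthogonal_def add.commute)
  qed
  have inner_D: "(\<sigma> - v) \<bullet> z = D \<bullet> z" if "z \<in> V" for z
    using c[OF that] by (simp add: cD inner_add_left)
  have "D = 0"
  proof (rule ccontr)
    assume D0: "D \<noteq> 0"
    \<comment> \<open>Both multiples \<open>r *\<^sub>R D\<close> and its negative are admissible.
      Comparing their equations gives \<open>r * (D \<bullet> D) = 0\<close>, so
      \<open>r = 0\<close> and \<open>f b = 0\<close>.\<close>
    have zero: "f b = 0" "A \<tau> \<sigma> + 2 * b * B \<tau> \<sigma> = 0" if fb: "f b \<ge> 0" for b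
    proof -
      obtain r where r: "r *\<^sub>R D \<in> V" "(r *\<^sub>R D) \<bullet> (r *\<^sub>R D) = f b"
        using D D0 fb by (rule V_vector_of_square)
      have r': "- (r *\<^sub>R D) \<in> V" "(- (r *\<^sub>R D)) \<bullet> (- (r *\<^sub>R D)) = f b"
        using subspace_neg[OF V r(1)] r(2) by simp_all
      have "A \<tau> \<sigma> + 2 * b * B \<tau> \<sigma> - 2 * (r * (D \<bullet> D)) = 0"
        using eq[OF r] unfolding inner_D[OF r(1)] by simp
      moreover have "A \<tau> \<sigma> + 2 * b * B \<tau> \<sigma> + 2 * (r * (D \<bullet> D)) = 0"
        using eq[OF r'] unfolding inner_D[OF r'(1)] by simp
      ultimately have "r * (D \<bullet> D) = 0" "A \<tau> \<sigma> + 2 * b * B \<tau> \<sigma> = 0" by linarith+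
      then show "f b = 0" "A \<tau> \<sigma> + 2 * b * B \<tau> \<sigma> = 0" using D0 r(2) by auto
    qed
    have nonneg: "f b1 \<ge> 0" "f b2 \<ge> 0" using z1(2) z2(2) inner_ge_zero by metis+
    \<comment> \<open>Without \<open>V\<close>-components, distinct points of \<open>frakX\<close>
      must differ in \<open>b\<close>.\<close>
    then have "z1 = 0" "z2 = 0" using zero(1)[OF nonneg(1)] zero(1)[OF nonneg(2)] z1(2) z2(2) by simp_all
    then have b: "b1 \<noteq> b2" using two(3) p q by auto
    have AB: "A \<tau> \<sigma> = 0" "B \<tau> \<sigma> = 0"
      using affine_eqs_two_points[OF zero(2)[OF nonneg(1)] zero(2)[OF nonneg(2)] b] .
    have "f b \<le> 0" for b using zero(1)[of b] by linarith
    from nonpos_quadratic_two_zeros[OF this[unfolded f_def] zero(1)[OF nonneg(1), unfolded f_def]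
        zero(1)[OF nonneg(2), unfolded f_def] b]
    have uv: "u \<bullet> u = 1" "\<alpha> = u \<bullet> v" "\<beta> = v \<bullet> v" by simp_all
    have \<tau>: "\<tau> = u \<bullet> (\<sigma> - v)" using AB(2)[unfolded B_def] uv(2) by (simp add: inner_diff_right)
    have "(\<sigma> - v) \<bullet> (\<sigma> - v) = \<tau>\<^sup>2"
      using AB(1)[unfolded A_def] uv(3)
      by (simp add: inner_diff_left inner_diff_right inner_commute)
    then have "\<sigma> - v = (u \<bullet> (\<sigma> - v)) *\<^sub>R u"
      using Cauchy_Schwarz_unit_eq[OF uv(1)] \<tau> by blast
    then have "(\<sigma> - v) \<bullet> D = 0" using u_orthogonal_V[OF D] by (metis inner_scaleR_left mult_zero_right)
    then show False using inner_D[OF D] D0 by simp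
  qed
  then have orth: "(\<sigma> - v) \<bullet> z = 0" if "z \<in> V" for z using inner_D[OF that] by simp
  then have eq0: "A \<tau> \<sigma> + 2 * b * B \<tau> \<sigma> = 0" if "z \<in> V" "z \<bullet> z = f b" for b z
    using eq[OF that] that(1) by simp
  \<comment> \<open>If both given points have the same \<open>b\<close>, one of them has a nonzero
    \<open>z\<close>, so \<open>f\<close> is positive there; a second value of \<open>b\<close> with
    \<open>f\<close> nonnegative exists, and rescaling \<open>z\<close> gives the vector for
    it.\<close>
  obtain b b' z z' where bz: "z \<in> V" "z \<bullet> z = f b" "z' \<in> V" "z' \<bullet> z' = f b'" "b \<noteq> b'"
  proof (cases "b1 = b2")
    case False
    then show thesis using that z1 z2 by blast
  next
    case True
    then have "z1 \<noteq> z2" using two(3) p q by auto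
    then obtain z where z: "z \<in> V" "z \<noteq> 0" "z \<bullet> z = f b1" using z1 z2 True by metis
    then have "f b1 > 0" by (metis inner_gt_zero_iff)
    then obtain b' where b': "b' \<noteq> b1" "f b' \<ge> 0"
      unfolding f_def by (rule quadratic_nonneg_nearby)
    obtain r where "r *\<^sub>R z \<in> V" "(r *\<^sub>R z) \<bullet> (r *\<^sub>R z) = f b'"
      using z(1,2) b'(2) by (rule V_vector_of_square)
    then show thesis using that z b'(1) by metis
  qed
  show "(\<tau>, \<sigma>) \<in> calS' k s w u \<alpha> v \<beta>"
    unfolding calS'_iff
    using orth affine_eqs_two_points[OF eq0[OF bz(1,2)] eq0[OF bz(3,4)] bz(5)] by blast
qed

end

text \<open>The first conjunct is the parenthetical remark on the affine span. Two distinct points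
  express that \<open>frakX\<close> has more than one element, including the infinite case, where
  \<open>card\<close> would be 0.\<close>

theorem theorem3p1:
  fixes s w :: "nat \<Rightarrow> real ^ 'n" and t :: "nat \<Rightarrow> real"
    and u v :: "real ^ 'n" and \<alpha> \<beta> :: real and m k :: nat
  assumes "1 \<le> m" and "m \<le> CARD('n) + 1"
    and "general_linear_position m s"
    and "k = CARD('n) + 1 - m"
    and "orthonormal_basis_of (orthogonal_comp (dirU m s)) k w"
    and "v_pair m k s t w (v, \<beta>)"
    and "u_pair m k s t w (u, \<alpha>)"
  shows "(\<forall>\<sigma>. (\<forall>j\<in>{1..k}. \<sigma> \<bullet> w j = gam s w j) \<longleftrightarrow> \<sigma> \<in> affine hull (s ` {1..m})) \<and>
    (\<forall>i\<in>{1..m}. (t i, s i) \<in> calS' k s w u \<alpha> v \<beta>) \<and>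
    calS' k s w u \<alpha> v \<beta> \<subseteq> calS m s t \<and>
    ((\<exists>p\<in>frakX m s t. \<exists>q\<in>frakX m s t. p \<noteq> q) \<longrightarrow> calS m s t = calS' k s w u \<alpha> v \<beta>)"
proof -
  interpret cone_system s w t u v \<alpha> \<beta> m k
    using assms by unfold_locales
  have "(\<forall>j\<in>{1..k}. \<sigma> \<bullet> w j = gam s w j) \<longleftrightarrow> \<sigma> \<in> affine hull (s ` {1..m})" for \<sigma>
    unfolding gam_iff_dirU affine_hull_eq_dirU[OF m] ..
  moreover have "calS m s t = calS' k s w u \<alpha> v \<beta>"
    if "\<exists>p\<in>frakX m s t. \<exists>q\<in>frakX m s t. p \<noteq> q"
    using that calS_subset_calS' calS'_subset_calS by (meson subset_antisym)
  ultimately show ?thesis using site_in_calS' calS'_subset_calS by blast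
qed

end
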